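(* Let $L_E$ be a real random variable with density $f_{L_E}(u)=\operatorname{sech}(\pi u)$, $u\in\mathbb{R}$. For every integer $k\ge1$ and every real $x\neq\frac12$, $$\mathfrak{E}^{-k}(x):=E\left(x-\tfrac12+\imath L_E\right)^{-k}=\begin{cases}\dfrac{\left(-\frac12\right)^{k-1}}{(k-1)!}\left(\psi^{(k-1)}\left(\frac{x+1}{2}\right)-\psi^{(k-1)}\left(\frac{x}{2}\right)\right), & x>\frac12,\\[3mm] \dfrac{\left(\frac12\right)^{k-1}}{(k-1)!}\left(\psi^{(k-1)}\left(\frac{1-x}{2}\right)-\psi^{(k-1)}\left(1-\frac{x}{2}\right)\right), & x<\frac12.\end{cases}$$
   Context: $\imath$ is the imaginary unit, $\psi=\Gamma'/\Gamma$ is the digamma function, and $\psi^{(j)}$ is its $j$-th derivative ($\psi^{(0)}=\psi$). $E$ denotes expectation: $E\,g(L_E)=\int_{\mathbb{R}}g(u)\operatorname{sech}(\pi u)\,du$. The function $h(\mathfrak{E}(x))$ of the Euler umbra is understood as $E\,h(x-\frac12+\imath L_E)$, here with $h(u)=u^{-k}$. *)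

theory Defs
  imports "HOL-Probability.Probability"
begin

definition sech :: "real \<Rightarrow> real" where
  "sech u = 1 / cosh u"

definition euler_umbra :: "'a measure \<Rightarrow> ('a \<Rightarrow> real) \<Rightarrow> (complex \<Rightarrow> complex) \<Rightarrow> real \<Rightarrow> complex" where
  "euler_umbra M L h x =
     prob_space.expectation M (\<lambda>\<omega>. h (complex_of_real (x - 1/2) + \<i> * complex_of_real (L \<omega>)))"

text \<open>The library defines \<^const>\<open>Digamma\<close> by a series; it is the logarithmic derivative of
  \<^const>\<open>Gamma\<close>.\<close>

lemma Digamma_eq_deriv_Gamma_div_Gamma:
  fixes x :: real
  assumes "x \<notin> \<int>\<^sub>\<le>\<^sub>0"
  shows "Digamma x = deriv Gamma x / Gamma x"
proof -
  have "(Gamma has_field_derivative (Gamma x * Digamma x)) (at x)"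
    using assms by (rule has_field_derivative_Gamma)
  hence "deriv Gamma x = Gamma x * Digamma x"
    by (rule DERIV_imp_deriv)
  thus ?thesis using assms by (simp add: Gamma_eq_zero_iff)
qed

end

theory Submission
  imports Defs "HOL-Complex_Analysis.Complex_Analysis"
begin

text \<open>
  For \<open>c > 0\<close> let \<open>I c\<close> be the integral of \<open>sech (\<pi> u) (c + \<i> u)\<^sup>-\<^sup>k\<close> over the real
  line; the left-hand side of the theorem is \<open>I (x - 1/2)\<close>. Substituting \<open>s = c + \<i> u\<close> turns
  \<open>sech (\<pi> u)\<close> into \<open>1 / cos (\<pi> (s - c))\<close>, which changes sign when the line of integration moves
  from \<open>Re s = c\<close> to \<open>Re s = c + 1\<close> and has, between these lines, a single simple pole at
  \<open>s = c + 1/2\<close>. The residue theorem on long rectangles therefore gives, for every function \<open>f\<close>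
  that is holomorphic near the strip and bounded on it, the sum of the \<open>sech\<close>-integrals of \<open>f\<close>
  along the two lines as \<open>2 f (c + 1/2)\<close> (\<open>sech_integral_add_shift\<close>). In particular
  \<open>I (y - 1/2) + I (y + 1/2) = 2 / y\<^sup>k\<close>.

  The normalised digamma difference on the right-hand side satisfies the same functional equation,
  by the recurrence \<open>\<psi>\<^sup>(\<^sup>m\<^sup>)(z + 1) = \<psi>\<^sup>(\<^sup>m\<^sup>)(z) + (-1)\<^sup>m m! / z\<^sup>m\<^sup>+\<^sup>1\<close> (\<open>Polygamma_diff_shift_and_bound\<close>),
  and both sides vanish at infinity. Their difference changes sign under \<open>y \<mapsto> y + 1\<close> and tends
  to 0, hence is 0 (\<open>sech_integral_inverse_power\<close>). The case \<open>x < 1/2\<close> reduces to this one by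
  the symmetry \<open>u \<mapsto> - u\<close>, which replaces \<open>x\<close> by \<open>1 - x\<close> and contributes the factor \<open>(-1)\<^sup>k\<close>.
\<close>

section \<open>Shifting the line of integration by one unit\<close>

lemma sech_real_pos [simp]: "sech u > 0"
  by (simp add: sech_def cosh_real_pos)

lemma norm_cos_pi_mult_ge:
  fixes z :: complex
  shows "pi * \<bar>Im z\<bar> \<le> norm (cos (pi * z))"
proof -
  have "(pi * \<bar>Im z\<bar>)\<^sup>2 \<le> ((exp (pi * Im z) - inverse (exp (pi * Im z))) / 2)\<^sup>2"
    using real_le_abs_sinh[of "pi * Im z"] by (simp add: abs_mult flip: abs_le_square_iff)
  also have "\<dots> \<le> norm (cos (pi * z)) ^ 2"
    by (simp add: norm_cos_squared power_divide)
  finally show ?thesis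
    by (rule power2_le_imp_le) simp
qed

lemma cos_pi_mult_eq_0_strip:
  fixes z :: complex
  assumes "cos (pi * z) = 0" "\<bar>Re z - 1/2\<bar> < 1"
  shows "z = 1/2"
proof -
  obtain n :: int where n: "pi * z = complex_of_real (n * pi) + of_real pi / 2"
    using assms(1) unfolding cos_eq_0 by blast
  hence "of_real pi * z = of_real pi * (of_int n + 1/2)"
    by (simp add: algebra_simps)
  hence z: "z = of_int n + 1/2"
    by simp
  with assms(2) have "n = 0"
    by auto
  with z show ?thesis
    by simp
qed

lemma cos_pi_mult_imaginary_line:
  "cos (pi * (Complex c u - of_real c)) = of_real (cosh (pi * u))"
  "cos (pi * (Complex (c + 1) u - of_real c)) = - of_real (cosh (pi * u))"
proof -
  have "pi * (Complex c u - of_real c) = \<i> * of_real (pi * u)"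
    by (simp add: complex_eq_iff)
  thus *: "cos (pi * (Complex c u - of_real c)) = of_real (cosh (pi * u))"
    by (simp only: cosh_conv_cos[symmetric])
      (simp add: cosh_def exp_of_real[symmetric] scaleR_conv_of_real)
  have "pi * (Complex (c + 1) u - of_real c) = pi * (Complex c u - of_real c) + of_real pi"
    by (simp add: complex_eq_iff algebra_simps)
  thus "cos (pi * (Complex (c + 1) u - of_real c)) = - of_real (cosh (pi * u))"
    by (simp add: * cos_add sin_of_real cos_of_real)
qed

text \<open>
  The rectangle has corners \<open>c \<plusminus> \<i> R\<close> and \<open>c + 1 \<plusminus> \<i> R\<close>. The residue at the centre gives the
  value \<open>2 f (c + 1/2)\<close>, and each horizontal edge, of length 1, contributes at most
  \<open>B / (\<pi> R)\<close>, because \<open>\<bar>cos (\<pi> z)\<bar> \<ge> \<bar>sinh (\<pi> Im z)\<bar> \<ge> \<pi> \<bar>Im z\<bar>\<close>.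
\<close>

lemma sech_rectangle_integral_bound:
  fixes f :: "complex \<Rightarrow> complex" and c R B :: real
  assumes S: "open S" "convex S" "{s. Re s \<in> {c..c+1}} \<subseteq> S"
    and holo: "f holomorphic_on S"
    and B: "\<And>s. Re s \<in> {c..c+1} \<Longrightarrow> norm (f s) \<le> B"
    and R: "R > 0"
  shows "norm (integral {-R..R} (\<lambda>u. sech (pi * u) *\<^sub>R (f (Complex c u) + f (Complex (c + 1) u)))
           - 2 * f (of_real (c + 1/2))) \<le> 2 * B / (pi * R)"
proof -
  \<comment> \<open>The margin 1/4 keeps the neighbouring zeros \<open>c - 1/2\<close> and \<open>c + 3/2\<close> of the cosine out of \<open>T\<close>.\<close>
  define T where "T = S \<inter> {s. Re s > c - 1/4} \<inter> {s. Re s < c + 5/4}"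
  define b where "b = complex_of_real (c + 1/2)"
  define q where "q = (\<lambda>s::complex. cos (pi * (s - of_real c)))"
  define g where "g = (\<lambda>s. f s / q s)"
  define p1 p2 p3 p4 where "p1 = Complex c (-R)" and "p2 = Complex (c+1) (-R)"
    and "p3 = Complex (c+1) R" and "p4 = Complex c R"
  have T: "open T" "convex T" "connected T"
  proof -
    show "open T" unfolding T_def
      by (intro open_Int S open_halfspace_Re_gt open_halfspace_Re_lt)
    show "convex T" unfolding T_def
      by (intro convex_Int S convex_halfspace_Re_gt convex_halfspace_Re_lt)
    thus "connected T" by (rule convex_connected)
  qed
  have T_S: "T \<subseteq> S" and strip_T: "{s. Re s \<in> {c..c+1}} \<subseteq> T"
    using S(3) by (auto simp: T_def)
  have b_T: "b \<in> T"
    using strip_T by (auto simp: b_def)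
  have q_nz: "q s \<noteq> 0" if "s \<in> T" "s \<noteq> b" for s
  proof
    assume "q s = 0"
    hence "s - of_real c = 1/2"
      using that by (intro cos_pi_mult_eq_0_strip) (auto simp: q_def T_def abs_less_iff)
    hence "s = 1/2 + of_real c"
      by (simp only: diff_eq_eq)
    with that show False
      by (simp add: b_def)
  qed
  have holo_g: "g holomorphic_on T - {b}"
    unfolding g_def using q_nz
    by (intro holomorphic_intros holomorphic_on_subset[OF holo])
      (use T_S in \<open>auto simp: q_def intro!: holomorphic_intros\<close>)
  have res: "residue g b = - f b / pi"
  proof (rule residue_simple'[OF T(1) b_T holo_g])
    have "(q has_field_derivative - of_real pi) (at b)"
      unfolding q_def b_def
      by (auto intro!: derivative_eq_intros simp: sin_of_real simp flip: of_real_mult)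
    hence "(\<lambda>s. (q s - q b) / (s - b)) \<midarrow>b\<rightarrow> - of_real pi"
      by (simp add: has_field_derivative_iff)
    moreover have "q b = 0"
      unfolding q_def b_def by (simp add: cos_of_real[symmetric])
    ultimately have "(\<lambda>s. q s / (s - b)) \<midarrow>b\<rightarrow> - of_real pi"
      by simp
    moreover have "f \<midarrow>b\<rightarrow> f b"
      using holo S(1) b_T T_S
      by (meson continuous_on_eq_continuous_at holomorphic_on_imp_continuous_on isCont_def subsetD)
    ultimately have "(\<lambda>s. f s / (q s / (s - b))) \<midarrow>b\<rightarrow> f b / - of_real pi"
      by (intro tendsto_divide) auto
    thus "(\<lambda>s. g s * (s - b)) \<midarrow>b\<rightarrow> - f b / pi"
      by (simp add: g_def)
  qed
  have cont_g: "continuous_on (T - {b}) g"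
    using holo_g by (rule holomorphic_on_imp_continuous_on)
  have sub: "path_image (rectpath p1 p3) \<subseteq> T - {b}"
    using strip_T R by (subst path_image_rectpath) (auto simp: p1_def p3_def b_def)
  have segs: "closed_segment p1 p2 \<subseteq> T - {b}" "closed_segment p2 p3 \<subseteq> T - {b}"
    "closed_segment p3 p4 \<subseteq> T - {b}" "closed_segment p4 p1 \<subseteq> T - {b}"
    using sub by (auto simp: rectpath_def Let_def path_image_join p1_def p2_def p3_def p4_def)
  have int_g: "g contour_integrable_on linepath p1 p2" "g contour_integrable_on linepath p2 p3"
    "g contour_integrable_on linepath p3 p4" "g contour_integrable_on linepath p4 p1"
    using segs by (auto intro!: contour_integrable_continuous_linepath continuous_on_subset[OF cont_g])
  have "contour_integral (rectpath p1 p3) g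
          = 2 * pi * \<i> * (\<Sum>p\<in>{b}. winding_number (rectpath p1 p3) p * residue g p)"
  proof (rule Residue_theorem[OF T(1,3) _ holo_g])
    show "\<forall>z. z \<notin> T \<longrightarrow> winding_number (rectpath p1 p3) z = 0"
      using strip_T R
      by (intro allI impI winding_number_rectpath_outside)
        (auto simp: p1_def p3_def in_cbox_complex_iff)
  qed (use sub in auto)
  moreover have "winding_number (rectpath p1 p3) b = 1"
    using R by (intro winding_number_rectpath) (auto simp: in_box_complex_iff p1_def p3_def b_def)
  ultimately have rect: "contour_integral (rectpath p1 p3) g = - 2 * \<i> * f b"
    by (simp add: res)
  have edges: "contour_integral (rectpath p1 p3) g =
      contour_integral (linepath p1 p2) g + (contour_integral (linepath p2 p3) g
       + (contour_integral (linepath p3 p4) g + contour_integral (linepath p4 p1) g))"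
    unfolding rectpath_def Let_def using int_g
    by (simp add: p1_def p2_def p3_def p4_def contour_integrable_joinI)
  have right: "contour_integral (linepath p2 p3) g
      = - \<i> * integral {-R..R} (\<lambda>u. sech (pi * u) *\<^sub>R f (Complex (c + 1) u))"
    using R by (subst contour_integral_linepath_same_Re[of _ "c+1" _ "-R" R])
      (auto simp: p2_def p3_def g_def q_def cos_pi_mult_imaginary_line sech_def scaleR_conv_of_real)
  have left: "contour_integral (linepath p4 p1) g
      = - \<i> * integral {-R..R} (\<lambda>u. sech (pi * u) *\<^sub>R f (Complex c u))"
  proof -
    have "contour_integral (linepath p4 p1) g = - contour_integral (linepath p1 p4) g"
      by (intro contour_integral_reverse_linepath continuous_on_subset[OF cont_g segs(4)])
    also have "contour_integral (linepath p1 p4) g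
        = \<i> * integral {-R..R} (\<lambda>u. sech (pi * u) *\<^sub>R f (Complex c u))"
      using R by (subst contour_integral_linepath_same_Re[of _ c _ "-R" R])
        (auto simp: p4_def p1_def g_def q_def cos_pi_mult_imaginary_line sech_def scaleR_conv_of_real)
    finally show ?thesis
      by simp
  qed
  have sum: "integral {-R..R} (\<lambda>u. sech (pi * u) *\<^sub>R (f (Complex c u) + f (Complex (c + 1) u)))
      = integral {-R..R} (\<lambda>u. sech (pi * u) *\<^sub>R f (Complex c u))
        + integral {-R..R} (\<lambda>u. sech (pi * u) *\<^sub>R f (Complex (c + 1) u))"
  proof -
    have cont: "continuous_on {-R..R} (\<lambda>u. f (Complex d u))" if "d \<in> {c..c+1}" for d
      using that S(3)
      by (intro continuous_on_compose2[OF holomorphic_on_imp_continuous_on[OF holo]])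
        (auto simp: Complex_eq intro!: continuous_intros)
    have "(\<lambda>u. sech (pi * u) *\<^sub>R f (Complex d u)) integrable_on {-R..R}" if "d \<in> {c..c+1}" for d
      using that unfolding sech_def
      by (intro integrable_continuous_interval continuous_intros cont) auto
    from integral_add[OF this[of c] this[of "c + 1"]] show ?thesis
      by (simp add: scaleR_add_right)
  qed
  have eq: "\<i> * (integral {-R..R} (\<lambda>u. sech (pi * u) *\<^sub>R (f (Complex c u) + f (Complex (c + 1) u)))
           - 2 * f b) = contour_integral (linepath p1 p2) g + contour_integral (linepath p3 p4) g"
    using edges unfolding rect left right sum by (simp add: field_simps)
  have B0: "B \<ge> 0"
    by (rule order_trans[OF norm_ge_zero B[of "of_real c"]]) simp
  have g_le: "norm (g s) \<le> B / (pi * R)" if "Re s \<in> {c..c+1}" "\<bar>Im s\<bar> = R" for s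
  proof -
    have "pi * R \<le> norm (q s)"
      using norm_cos_pi_mult_ge[of "s - of_real c"] that by (simp add: q_def)
    thus ?thesis
      unfolding g_def norm_divide using B[OF that(1)] B0 R by (intro frac_le) auto
  qed
  have "norm (contour_integral (linepath p1 p2) g) \<le> B / (pi * R) * norm (p2 - p1)"
    using R B0 by (intro contour_integral_bound_linepath int_g g_le)
      (auto simp: p1_def p2_def closed_segment_same_Im closed_segment_eq_real_ivl)
  moreover have "norm (contour_integral (linepath p3 p4) g) \<le> B / (pi * R) * norm (p4 - p3)"
    using R B0 by (intro contour_integral_bound_linepath int_g g_le)
      (auto simp: p3_def p4_def closed_segment_same_Im closed_segment_eq_real_ivl)
  moreover have "norm (p2 - p1) = 1" "norm (p4 - p3) = 1"
    by (auto simp: p1_def p2_def p3_def p4_def cmod_def)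
  ultimately have "norm (contour_integral (linepath p1 p2) g + contour_integral (linepath p3 p4) g)
      \<le> B / (pi * R) + B / (pi * R)"
    using norm_triangle_ineq[of "contour_integral (linepath p1 p2) g" "contour_integral (linepath p3 p4) g"]
    by (simp only: mult_1_right)
  also have "\<dots> = 2 * B / (pi * R)"
    by (simp only: add_divide_distrib mult_2)
  finally show ?thesis
    by (simp only: eq[symmetric] norm_mult norm_ii mult_1_left b_def)
qed

lemma integrable_sech_scaleR_bounded:
  fixes f :: "real \<Rightarrow> 'b::{banach, second_countable_topology}"
  assumes "integrable lborel (\<lambda>u. sech (pi * u))"
    and f: "f \<in> borel_measurable borel" and B: "\<And>u. norm (f u) \<le> B"
  shows "integrable lborel (\<lambda>u. sech (pi * u) *\<^sub>R f u)"
proof (rule Bochner_Integration.integrable_bound)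
  show "integrable lborel (\<lambda>u. B * sech (pi * u))"
    using assms(1) by simp
  show "(\<lambda>u. sech (pi * u) *\<^sub>R f u) \<in> borel_measurable lborel"
    using f borel_measurable_integrable[OF assms(1)] by measurable
  have "B \<ge> 0"
    using B[of 0] norm_ge_zero order_trans by blast
  with B show "AE u in lborel. norm (sech (pi * u) *\<^sub>R f u) \<le> norm (B * sech (pi * u))"
    by (auto simp: abs_mult mult.commute[of B] intro!: mult_left_mono)
qed

text \<open>
  In terms of a random variable \<open>L\<close> with density \<open>sech (\<pi> u)\<close> and \<open>b = c + 1/2\<close>, the average of the
  expectations of \<open>f (b - 1/2 + \<i> L)\<close> and \<open>f (b + 1/2 + \<i> L)\<close> is \<open>f b\<close>.
\<close>

lemma sech_integral_add_shift:
  fixes f :: "complex \<Rightarrow> complex" and c B :: real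
  assumes sech: "integrable lborel (\<lambda>u. sech (pi * u))"
    and S: "open S" "convex S" "{s. Re s \<in> {c..c+1}} \<subseteq> S"
    and holo: "f holomorphic_on S"
    and B: "\<And>s. Re s \<in> {c..c+1} \<Longrightarrow> norm (f s) \<le> B"
  shows "(\<integral>u. sech (pi * u) *\<^sub>R f (Complex c u) \<partial>lborel)
       + (\<integral>u. sech (pi * u) *\<^sub>R f (Complex (c + 1) u) \<partial>lborel) = 2 * f (of_real (c + 1/2))"
proof -
  define h where "h = (\<lambda>u. sech (pi * u) *\<^sub>R (f (Complex c u) + f (Complex (c + 1) u)))"
  have cont: "continuous_on UNIV (\<lambda>u. f (Complex d u))" if "d \<in> {c..c+1}" for d
    using that S(3)
    by (intro continuous_on_compose2[OF holomorphic_on_imp_continuous_on[OF holo]])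
      (auto simp: Complex_eq intro!: continuous_intros)
  have int: "integrable lborel (\<lambda>u. sech (pi * u) *\<^sub>R f (Complex d u))" if "d \<in> {c..c+1}" for d
    using that
    by (intro integrable_sech_scaleR_bounded[OF sech _ B] borel_measurable_continuous_onI cont) auto
  have int_h: "integrable lborel h"
    unfolding h_def scaleR_add_right by (intro Bochner_Integration.integrable_add int) auto
  have cont_h: "continuous_on UNIV h"
    unfolding h_def sech_def by (intro continuous_intros cont) auto
  have "((\<lambda>R. \<integral>u. indicator {-R..R} u *\<^sub>R h u \<partial>lborel) \<longlongrightarrow> (\<integral>u. h u \<partial>lborel)) at_top"
  proof (rule integral_dominated_convergence_at_top[where w = "\<lambda>u. norm (h u)"])
    show "h \<in> borel_measurable lborel" "\<And>R. (\<lambda>u. indicator {-R..R} u *\<^sub>R h u) \<in> borel_measurable lborel"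
      using int_h by (auto intro!: borel_measurable_scaleR)
    show "AE u in lborel. ((\<lambda>R. indicator {-R..R} u *\<^sub>R h u) \<longlongrightarrow> h u) at_top"
    proof (intro AE_I2 tendsto_eventually)
      fix u :: real
      show "\<forall>\<^sub>F R in at_top. indicator {-R..R} u *\<^sub>R h u = h u"
        using eventually_ge_at_top[of "\<bar>u\<bar>"] by eventually_elim (auto simp: indicator_def)
    qed
    show "\<forall>\<^sub>F R in at_top. AE u in lborel. norm (indicator {-R..R} u *\<^sub>R h u) \<le> norm (h u)"
      by (auto simp: indicator_def intro!: always_eventually)
  qed (use int_h in auto)
  moreover have "(\<integral>u. indicator {-R..R} u *\<^sub>R h u \<partial>lborel) = integral {-R..R} h" for R
    using set_borel_integral_eq_integral(2)[OF borel_integrable_atLeastAtMost'[OF continuous_on_subset[OF cont_h]], of "-R" R]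
    by (simp add: set_lebesgue_integral_def)
  ultimately have lim1: "((\<lambda>R. integral {-R..R} h) \<longlongrightarrow> (\<integral>u. h u \<partial>lborel)) at_top"
    by simp
  have "((\<lambda>R. integral {-R..R} h - 2 * f (of_real (c + 1/2))) \<longlongrightarrow> 0) at_top"
  proof (rule Lim_null_comparison)
    show "\<forall>\<^sub>F R in at_top. norm (integral {-R..R} h - 2 * f (of_real (c + 1/2))) \<le> 2 * B / (pi * R)"
      using eventually_gt_at_top[of 0]
      by eventually_elim (unfold h_def, rule sech_rectangle_integral_bound[OF S holo B])
    show "((\<lambda>R. 2 * B / (pi * R)) \<longlongrightarrow> 0) at_top"
      by (intro real_tendsto_divide_at_top[OF tendsto_const]
          filterlim_tendsto_pos_mult_at_top[OF tendsto_const pi_gt_zero] filterlim_ident)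
  qed
  hence lim2: "((\<lambda>R. integral {-R..R} h) \<longlongrightarrow> 2 * f (of_real (c + 1/2))) at_top"
    by (simp add: LIM_zero_iff)
  have "(\<integral>u. h u \<partial>lborel) = 2 * f (of_real (c + 1/2))"
    using tendsto_unique[OF _ lim1 lim2] by simp
  thus ?thesis
    unfolding h_def scaleR_add_right by (subst (asm) Bochner_Integration.integral_add) (auto intro: int)
qed

section \<open>The functional equation for digamma differences\<close>

text \<open>
  With \<open>m = k - 1\<close> and \<open>y = x\<close>, this is the right-hand side of the theorem for \<open>x > 1/2\<close>. The library's
  \<^const>\<open>Polygamma\<close> \<open>m\<close> is the \<open>m\<close>-th derivative of \<^const>\<open>Digamma\<close>.
\<close>

definition Polygamma_diff :: "nat \<Rightarrow> real \<Rightarrow> real" where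
  "Polygamma_diff m y
     = (- (1/2)) ^ m / fact m * (Polygamma m ((y + 1) / 2) - Polygamma m (y / 2))"

text \<open>
  The bound holds because \<^const>\<open>Polygamma\<close> \<open>m\<close> is monotone on the positive reals, increasing or
  decreasing according to the parity of \<open>m\<close>: its increment over a half unit is dominated by the one
  over a full unit, which the recurrence for \<open>\<psi>\<^sup>(\<^sup>m\<^sup>)\<close> makes explicit.
\<close>

lemma Polygamma_diff_shift_and_bound:
  assumes y: "y > 0"
  shows "Polygamma_diff m y + Polygamma_diff m (y + 1) = 2 / y ^ Suc m"
    and "\<bar>Polygamma_diff m y\<bar> \<le> 2 / y ^ Suc m"
proof -
  let ?P = "Polygamma m :: real \<Rightarrow> real"
  have "?P (y / 2 + 1) - ?P (y / 2) = (-1) ^ m * fact m / (y / 2) ^ Suc m"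
    using y by (subst Polygamma_plus1) auto
  hence "(- (1/2)) ^ m / fact m * (?P (y / 2 + 1) - ?P (y / 2))
      = ((- (1/2)) * (-1)) ^ m / (y / 2) ^ Suc m"
    by (simp only: power_mult_distrib) simp
  also have "\<dots> = 2 / y ^ Suc m"
    by (simp add: power_divide)
  finally have step: "(- (1/2)) ^ m / fact m * (?P (y / 2 + 1) - ?P (y / 2)) = 2 / y ^ Suc m" .

  have "(y + 1 + 1) / 2 = y / 2 + 1"
    by simp
  thus "Polygamma_diff m y + Polygamma_diff m (y + 1) = 2 / y ^ Suc m"
    unfolding step[symmetric] Polygamma_diff_def
    by (simp only: ring_distribs)

  have "\<bar>?P ((y + 1) / 2) - ?P (y / 2)\<bar> \<le> \<bar>?P (y / 2 + 1) - ?P (y / 2)\<bar>"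
  proof (cases "even m")
    case True
    thus ?thesis
      using Polygamma_real_strict_mono[of "y/2" "(y+1)/2" m]
        Polygamma_real_strict_mono[of "(y+1)/2" "y/2+1" m] y
      by simp
  next
    case False
    thus ?thesis
      using Polygamma_real_strict_antimono[of "y/2" "(y+1)/2" m]
        Polygamma_real_strict_antimono[of "(y+1)/2" "y/2+1" m] y
      by simp
  qed
  hence "\<bar>Polygamma_diff m y\<bar> \<le> \<bar>(- (1/2)) ^ m / fact m * (?P (y / 2 + 1) - ?P (y / 2))\<bar>"
    unfolding Polygamma_diff_def abs_mult by (intro mult_left_mono) auto
  also have "\<dots> = 2 / y ^ Suc m"
    using y unfolding step by simp
  finally show "\<bar>Polygamma_diff m y\<bar> \<le> 2 / y ^ Suc m" .
qed

lemma antiperiodic_tendsto_0_imp_eq_0: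
  fixes D :: "real \<Rightarrow> 'b::real_normed_vector"
  assumes step: "\<And>y. y \<ge> a \<Longrightarrow> D (y + 1) = - D y"
    and lim: "(D \<longlongrightarrow> 0) at_top"
  shows "D a = 0"
proof -
  have "norm (D (a + real n)) = norm (D a)" for n
  proof (induction n)
    case (Suc n)
    have "D (a + real (Suc n)) = - D (a + real n)"
      using step[of "a + real n"] by (simp add: add_ac)
    with Suc show ?case by simp
  qed simp
  moreover have "(\<lambda>n. norm (D (a + real n))) \<longlonglongrightarrow> norm (0 :: 'b)"
    by (intro tendsto_norm filterlim_compose[OF lim]
        filterlim_tendsto_add_at_top[OF tendsto_const] filterlim_real_sequentially)
  ultimately show ?thesis
    by (simp add: LIMSEQ_const_iff)
qed

section \<open>Negative moments\<close>

lemma sech_integral_inverse_power: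
  assumes sech: "integrable lborel (\<lambda>u. sech (pi * u))" and y: "y > 1/2"
  shows "(\<integral>u. sech (pi * u) *\<^sub>R inverse (Complex (y - 1/2) u ^ Suc m) \<partial>lborel)
           = of_real (Polygamma_diff m y)"
proof -
  define f :: "complex \<Rightarrow> complex" where "f = (\<lambda>s. inverse (s ^ Suc m))"
  define J where "J = (\<lambda>y. \<integral>u. sech (pi * u) *\<^sub>R f (Complex (y - 1/2) u) \<partial>lborel)"
  have holo: "f holomorphic_on {s. Re s > 0}"
    unfolding f_def by (intro holomorphic_intros) auto
  have f_le: "norm (f s) \<le> inverse (c ^ Suc m)" if "c > 0" "c \<le> Re s" for s c
  proof -
    have "c \<le> norm s"
      using that complex_Re_le_cmod[of s] by linarith
    with that show ?thesis
      unfolding f_def norm_inverse norm_power by (intro le_imp_inverse_le power_mono) auto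
  qed
  have step: "J (z + 1) - of_real (Polygamma_diff m (z + 1)) = - (J z - of_real (Polygamma_diff m z))"
    if "z \<ge> y" for z
  proof -
    have z: "z > 1/2" using that y by simp
    have "J z + J (z + 1) = 2 * f (of_real (z - 1/2 + 1/2))"
      unfolding J_def using z sech_integral_add_shift[OF sech open_halfspace_Re_gt[of 0] convex_halfspace_Re_gt[of 0]
         _ holo f_le, of "z - 1/2" "z - 1/2"]
      by (simp add: algebra_simps subset_iff)
    also have "\<dots> = of_real (2 / z ^ Suc m)"
      by (simp add: f_def divide_simps)
    also have "\<dots> = of_real (Polygamma_diff m z + Polygamma_diff m (z + 1))"
      using z by (subst Polygamma_diff_shift_and_bound(1)) auto
    finally show ?thesis
      by (simp add: algebra_simps)
  qed
  define C where "C = (\<integral>u. sech (pi * u) \<partial>lborel)"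
  have J_le: "norm (J z) \<le> C * inverse ((z - 1/2) ^ Suc m)" if "z > 1/2" for z
  proof -
    have "norm (J z) \<le> (\<integral>u. sech (pi * u) * inverse ((z - 1/2) ^ Suc m) \<partial>lborel)"
      unfolding J_def
    proof (rule Bochner_Integration.integral_norm_bound_integral)
      show "integrable lborel (\<lambda>u. sech (pi * u) *\<^sub>R f (Complex (z - 1/2) u))"
        using that
        by (intro integrable_sech_scaleR_bounded[OF sech _ f_le[of "z - 1/2"]])
          (auto simp: f_def Complex_eq)
      show "norm (sech (pi * u) *\<^sub>R f (Complex (z - 1/2) u))
              \<le> sech (pi * u) * inverse ((z - 1/2) ^ Suc m)" for u
        using that f_le[of "z - 1/2" "Complex (z - 1/2) u"]
        by (auto intro!: mult_left_mono simp: abs_of_pos simp del: power_Suc)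
    qed (use sech in simp)
    thus ?thesis by (simp add: C_def)
  qed
  have "((\<lambda>z. J z - of_real (Polygamma_diff m z)) \<longlongrightarrow> 0) at_top"
  proof (rule Lim_null_comparison)
    show "\<forall>\<^sub>F z in at_top. norm (J z - of_real (Polygamma_diff m z))
            \<le> C * inverse ((z - 1/2) ^ Suc m) + 2 / z ^ Suc m"
      using eventually_gt_at_top[of "1/2"]
    proof eventually_elim
      case (elim z)
      thus ?case
        using norm_triangle_ineq4[of "J z" "of_real (Polygamma_diff m z)"] J_le[of z] Polygamma_diff_shift_and_bound(2)[of z m]
        by (simp del: power_Suc)
    qed
    have shift: "filterlim (\<lambda>z::real. z - 1/2) at_top at_top"
      using filterlim_tendsto_add_at_top[OF tendsto_const filterlim_ident, of "-1/2 :: real"]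
      by simp
    have "((\<lambda>z. C / (z - 1/2) ^ Suc m + 2 / z ^ Suc m) \<longlongrightarrow> 0 + 0) at_top"
      by (intro tendsto_add real_tendsto_divide_at_top[OF tendsto_const] filterlim_pow_at_top
          shift filterlim_ident) auto
    thus "((\<lambda>z. C * inverse ((z - 1/2) ^ Suc m) + 2 / z ^ Suc m) \<longlongrightarrow> 0) at_top"
      by (simp only: divide_inverse add_0_left)
  qed
  from antiperiodic_tendsto_0_imp_eq_0[of y, OF step this] show ?thesis
    by (simp add: J_def f_def)
qed

lemma distributed_integral_scaleR:
  fixes g :: "'c \<Rightarrow> 'b::{banach, second_countable_topology}"
  assumes D: "distributed M N X (\<lambda>u. ennreal (p u))" and p: "\<And>u. p u \<ge> 0"
    and g: "g \<in> borel_measurable N"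
  shows "(\<integral>\<omega>. g (X \<omega>) \<partial>M) = (\<integral>u. p u *\<^sub>R g u \<partial>N)"
proof -
  have "(\<integral>\<omega>. g (X \<omega>) \<partial>M) = (\<integral>u. g u \<partial>density N (\<lambda>u. ennreal (p u)))"
    using D g by (subst distributed_distr_eq_density[OF D, symmetric], subst integral_distr)
      (auto dest: distributed_measurable)
  also have "\<dots> = (\<integral>u. p u *\<^sub>R g u \<partial>N)"
    using g p distributed_real_measurable[OF p D] by (intro integral_density) auto
  finally show ?thesis .
qed

theorem mainTheorem5:
  fixes M :: "'a measure" and L :: "'a \<Rightarrow> real" and k :: nat and x :: real
  assumes "prob_space M"
    and "distributed M lborel L (\<lambda>u. ennreal (sech (pi * u)))"
    and "k \<ge> 1"
    and "x \<noteq> 1/2"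
  shows "euler_umbra M L (\<lambda>u. u powi (- int k)) x =
    complex_of_real
      (if x > 1/2
       then (- (1/2)) ^ (k - 1) / fact (k - 1) *
         ((deriv ^^ (k - 1)) Digamma ((x + 1) / 2) - (deriv ^^ (k - 1)) Digamma (x / 2))
       else (1/2) ^ (k - 1) / fact (k - 1) *
         ((deriv ^^ (k - 1)) Digamma ((1 - x) / 2) - (deriv ^^ (k - 1)) Digamma (1 - x / 2)))"
proof -
  interpret prob_space M by fact
  obtain m where k: "k = Suc m"
    using assms(3) by (cases k) auto
  have sech: "integrable lborel (\<lambda>u. sech (pi * u))"
    using distributed_integrable[OF assms(2), of "\<lambda>_. 1"] by (simp add: less_imp_le)
  define I where "I = (\<lambda>c. \<integral>u. sech (pi * u) *\<^sub>R inverse (Complex c u ^ Suc m) \<partial>lborel)"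
  have "euler_umbra M L (\<lambda>u. u powi (- int k)) x
          = expectation (\<lambda>\<omega>. inverse (Complex (x - 1/2) (L \<omega>) ^ Suc m))"
    by (simp add: euler_umbra_def k power_int_minus Complex_eq del: power_Suc of_nat_Suc)
  also have "\<dots> = I (x - 1/2)"
    unfolding I_def
    by (rule distributed_integral_scaleR[OF assms(2)]) (auto simp: less_imp_le Complex_eq)
  finally have umbra: "euler_umbra M L (\<lambda>u. u powi (- int k)) x = I (x - 1/2)" .
  have deriv: "(deriv ^^ m) Digamma y = Polygamma m y" if "y > 0" for y :: real
    using that by (subst higher_deriv_Polygamma) (auto elim!: nonpos_Ints_cases)
  show ?thesis
  proof (cases "x > 1/2")
    case True
    thus ?thesis
      using sech_integral_inverse_power[OF sech True, of m]
      unfolding umbra I_def by (simp add: k deriv Polygamma_diff_def)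
  next
    case False
    with assms(4) have x: "x < 1/2" by simp
    have refl: "Complex (x - 1/2) (-u) = - Complex ((1 - x) - 1/2) u" for u
      by (simp add: complex_eq_iff)
    have "I (x - 1/2) = (\<integral>u. sech (pi * u) *\<^sub>R inverse (Complex (x - 1/2) (-u) ^ Suc m) \<partial>lborel)"
      unfolding I_def by (subst lborel_integral_real_affine[of "-1" _ 0]) (auto simp: sech_def)
    also have "\<dots> = (-1) ^ Suc m * I ((1 - x) - 1/2)"
      unfolding refl I_def power_minus[of "Complex _ _"]
      by (subst integral_mult_right_zero[symmetric], rule Bochner_Integration.integral_cong)
        (auto simp: power_inverse[symmetric] scaleR_conv_of_real)
    also have "I ((1 - x) - 1/2) = of_real (Polygamma_diff m (1 - x))"
      unfolding I_def using sech_integral_inverse_power[OF sech, of "1 - x" m] x by simp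
    finally have "I (x - 1/2) = of_real ((-1) ^ Suc m * Polygamma_diff m (1 - x))"
      by simp
    also have "(-1) ^ Suc m * Polygamma_diff m (1 - x)
        = (1/2) ^ m / fact m * (Polygamma m ((1 - x) / 2) - Polygamma m (1 - x / 2))"
    proof -
      have "(1 - x + 1) / 2 = 1 - x / 2"
        by simp
      moreover have "(-1) ^ m * (- (1/2)) ^ m = (1/2 :: real) ^ m"
        by (simp flip: power_mult_distrib)
      moreover have "(-1) ^ Suc m * Polygamma_diff m (1 - x)
          = (-1) ^ m * (- (1/2)) ^ m / fact m
              * (Polygamma m ((1 - x) / 2) - Polygamma m ((1 - x + 1) / 2))"
        by (simp add: Polygamma_diff_def algebra_simps diff_divide_distrib)
      ultimately show ?thesis
        by (simp only:)
    qed
    finally show ?thesis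
      using x unfolding umbra by (simp add: k deriv)
  qed
qed

end
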